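(* Let $(S,0)$ be a pointed metrizable topological space. Then the group $G=\mathrm{Homeo}_+^{(S,0)}(\mathbb{R},0)^{\mathrm{germ}}$ of germs at $(0,0)\in\mathbb{R}\times S$ of local homeomorphisms of $\mathbb{R}\times S$ of the form $(x,s)\mapsto(h_s(x),s)$ fixing $(0,0)$, where each $h_s$ is a local orientation-preserving homeomorphism of $\mathbb{R}$, is left-orderable.
   Context: A group $G$ is left-orderable if there is a total order $\prec$ on $G$ such that for all $f,g,h\in G$, $g\prec h$ implies $fg\prec fh$. Here $0\in S$ is the base point. A local homeomorphism of $\mathbb{R}\times S$ at $(0,0)$ is a homeomorphism from an open neighborhood of $(0,0)$ onto an open subset of $\mathbb{R}\times S$; two of them have the same germ at $(0,0)$ if they agree on some neighborhood of $(0,0)$. The group operation is composition of germs, and the identity element is the germ of the identity map of $\mathbb{R}\times S$. *)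

theory Defs
  imports "HOL-Analysis.Analysis" "HOL-Algebra.Group"
begin

definition left_orderable :: "('a, 'b) monoid_scheme \<Rightarrow> bool" where
  "left_orderable G \<longleftrightarrow>
     (\<exists>r. strict_linear_order_on (carrier G) r \<and>
          (\<forall>f\<in>carrier G. \<forall>g\<in>carrier G. \<forall>h\<in>carrier G.
             (g, h) \<in> r \<longrightarrow> (f \<otimes>\<^bsub>G\<^esub> g, f \<otimes>\<^bsub>G\<^esub> h) \<in> r))"

text \<open>
  Locally defined maps are partial functions, so that each carries its domain, \<open>\<circ>\<^sub>m\<close> is
  composition on the largest possible domain, and two of them are equal only if their domains are.
\<close>

definition local_homeo :: "'a topology \<Rightarrow> ('a \<rightharpoonup> 'a) \<Rightarrow> bool" where
  "local_homeo X f \<longleftrightarrow>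
     openin X (dom f) \<and> openin X (ran f) \<and>
     homeomorphic_map (subtopology X (dom f)) (subtopology X (ran f)) (\<lambda>x. the (f x))"

text \<open>
  The domain of a local homeomorphism of the line need not be connected, so preservation of
  orientation is required locally, i.e. on each component of the domain. The empty map is allowed:
  it is the fibre \<open>h\<^sub>s\<close> over every \<open>s\<close> that the domain of a fibred map does not meet.
\<close>

definition op_local_homeo :: "(real \<rightharpoonup> real) \<Rightarrow> bool" where
  "op_local_homeo h \<longleftrightarrow>
     local_homeo euclideanreal h \<and>
     (\<forall>x\<in>dom h. \<exists>e>0. ball x e \<subseteq> dom h \<and> strict_mono_on (ball x e) (\<lambda>y. the (h y)))"

text \<open>The partial map \<open>(x, s) \<mapsto> (h\<^sub>s(x), s)\<close>, defined where \<open>h\<^sub>s(x)\<close> is.\<close>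

definition fibred_map :: "('s \<Rightarrow> real \<rightharpoonup> real) \<Rightarrow> real \<times> 's \<rightharpoonup> real \<times> 's" where
  "fibred_map h = (\<lambda>(x, s). map_option (\<lambda>y. (y, s)) (h s x))"

text \<open>The base point of \<open>S\<close> is \<open>p\<close>; the equation in the second line also says that
  \<open>(0, p)\<close> is in the domain.\<close>

definition fibred_homeos :: "'s topology \<Rightarrow> 's \<Rightarrow> (real \<times> 's \<rightharpoonup> real \<times> 's) set" where
  "fibred_homeos S p =
     {f. local_homeo (prod_topology euclideanreal S) f \<and> f (0, p) = Some (0, p) \<and>
         (\<exists>h. f = fibred_map h \<and> (\<forall>s\<in>topspace S. op_local_homeo (h s)))}"

definition germ_rel :: "'s topology \<Rightarrow> 's \<Rightarrow> (real \<times> 's \<rightharpoonup> real \<times> 's) rel" where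
  "germ_rel S p =
     {(f, g). f \<in> fibred_homeos S p \<and> g \<in> fibred_homeos S p \<and>
        (\<exists>W. openin (prod_topology euclideanreal S) W \<and> (0, p) \<in> W \<and>
             W \<subseteq> dom f \<inter> dom g \<and> (\<forall>w\<in>W. f w = g w))}"

definition germ_group :: "'s topology \<Rightarrow> 's \<Rightarrow> (real \<times> 's \<rightharpoonup> real \<times> 's) set monoid" where
  "germ_group S p =
     \<lparr>carrier = fibred_homeos S p // germ_rel S p,
      mult = (\<lambda>a b. \<Union>f\<in>a. \<Union>g\<in>b. germ_rel S p `` {f \<circ>\<^sub>m g}),
      one = germ_rel S p `` {Some |` topspace (prod_topology euclideanreal S)}\<rparr>"

end

theory Submission
  imports Defs
begin

text \<open>
  Fix a strict well-order of \<open>\<real> \<times> S\<close>. For a neighbourhood \<open>W\<close> of \<open>(0, p)\<close>, compare two fibred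
  homeomorphisms that do not agree on \<open>W\<close> at the least point of \<open>W\<close> where they differ, using the
  order of \<open>\<real>\<close>. For small \<open>W\<close> this is a strict linear order, and it is invariant under left
  composition because a fibred homeomorphism is increasing on the fibres of a small box around
  \<open>(0, p)\<close>. Since the least point of difference depends on \<open>W\<close>, the order on germs is the limit of
  these orders along an ultrafilter refining the filter of arbitrarily small neighbourhoods.
\<close>

section \<open>Local homeomorphisms as partial maps\<close>

text \<open>With the subspaces gone, the last two conditions mirror each other, so composites and
  inverses reduce to set algebra. Openness of domain and range is the case where \<open>U\<close> is
  the whole space, and a set that is open in an open subspace is open in \<open>X\<close>.\<close>

lemma local_homeo_iff:
  "local_homeo X f \<longleftrightarrow>
     dom f \<subseteq> topspace X \<and> ran f \<subseteq> topspace X \<and>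
     (\<forall>x y z. f x = Some z \<longrightarrow> f y = Some z \<longrightarrow> x = y) \<and>
     (\<forall>U. openin X U \<longrightarrow> openin X {x. \<exists>y\<in>U. f x = Some y}) \<and>
     (\<forall>U. openin X U \<longrightarrow> openin X {y. \<exists>x\<in>U. f x = Some y})"
  (is "_ \<longleftrightarrow> ?D \<and> ?R \<and> ?I \<and> ?P \<and> ?O")
proof
  assume L: "local_homeo X f"
  let ?Y = "subtopology X (dom f)" and ?Z = "subtopology X (ran f)" and ?g = "\<lambda>x. the (f x)"
  have od: "openin X (dom f)" and oran: "openin X (ran f)"
    and h: "homeomorphic_map ?Y ?Z ?g"
    using L by (auto simp: local_homeo_def)
  have D: ?D and R: ?R using od oran openin_subset by blast+
  have tY: "topspace ?Y = dom f" and tZ: "topspace ?Z = ran f"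
    using D R by auto
  have inj: "inj_on ?g (dom f)"
    using homeomorphic_imp_injective_map[OF h] tY by simp
  have I: ?I
    using inj by (auto simp: inj_on_def dom_def)
  have P: ?P
  proof (intro allI impI)
    fix U assume U: "openin X U"
    have "openin ?Z (U \<inter> ran f)" using U by (simp add: openin_subtopology_Int)
    then have "openin ?Y {x \<in> topspace ?Y. ?g x \<in> U \<inter> ran f}"
      using homeomorphic_imp_continuous_map[OF h] openin_continuous_map_preimage by blast
    moreover have "{x \<in> topspace ?Y. ?g x \<in> U \<inter> ran f} = {x. \<exists>y\<in>U. f x = Some y}"
      unfolding tY by (auto simp: ran_def)
    ultimately show "openin X {x. \<exists>y\<in>U. f x = Some y}"
      using od openin_trans_full by metis
  qed
  have O: ?O
  proof (intro allI impI)
    fix U assume U: "openin X U"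
    have "openin ?Y (U \<inter> dom f)" using U by (simp add: openin_subtopology_Int)
    then have "openin ?Z (?g ` (U \<inter> dom f))"
      using homeomorphic_imp_open_map[OF h] by (auto simp: open_map_def)
    moreover have "?g ` (U \<inter> dom f) = {y. \<exists>x\<in>U. f x = Some y}"
      by (force simp: image_iff)
    ultimately show "openin X {y. \<exists>x\<in>U. f x = Some y}"
      using oran openin_trans_full by metis
  qed
  show "?D \<and> ?R \<and> ?I \<and> ?P \<and> ?O" using D R I P O by blast
next
  assume A: "?D \<and> ?R \<and> ?I \<and> ?P \<and> ?O"
  let ?Y = "subtopology X (dom f)" and ?Z = "subtopology X (ran f)" and ?g = "\<lambda>x. the (f x)"
  have tY: "topspace ?Y = dom f" and tZ: "topspace ?Z = ran f"
    using A by auto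
  have "dom f = {x. \<exists>y\<in>topspace X. f x = Some y}"
    using A by (auto simp: ran_def)
  then have od: "openin X (dom f)" using A by simp
  have "ran f = {y. \<exists>x\<in>topspace X. f x = Some y}"
    using A by (auto simp: ran_def)
  then have oran: "openin X (ran f)" using A by simp
  have "continuous_map ?Y ?Z ?g"
    unfolding continuous_map_def tY tZ
  proof (intro conjI allI impI)
    show "?g \<in> dom f \<rightarrow> ran f" by (auto simp: ran_def)
    fix U assume "openin ?Z U"
    then have U: "openin X U" using oran openin_trans_full by blast
    have "{x \<in> dom f. ?g x \<in> U} = {x. \<exists>y\<in>U. f x = Some y} \<inter> dom f" by auto
    then show "openin ?Y {x \<in> dom f. ?g x \<in> U}"
      using A U by (simp add: openin_subtopology_Int)
  qed
  moreover have "open_map ?Y ?Z ?g"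
    unfolding open_map_def
  proof (intro allI impI)
    fix U assume UY: "openin ?Y U"
    then have U: "openin X U" using od openin_trans_full by blast
    have "U \<subseteq> dom f" using openin_subset[OF UY] tY by simp
    then have "?g ` U = {y. \<exists>x\<in>U. f x = Some y} \<inter> ran f"
      by (force simp: image_iff ran_def)
    then show "openin ?Z (?g ` U)"
      using A U by (simp add: openin_subtopology_Int)
  qed
  moreover have "?g ` topspace ?Y = topspace ?Z"
    unfolding tY tZ by (force simp: image_iff ran_def)
  moreover have "inj_on ?g (topspace ?Y)"
    unfolding tY using A by (auto simp: inj_on_def)
  ultimately show "local_homeo X f"
    using od oran by (simp add: local_homeo_def bijective_open_imp_homeomorphic_map)
qed

lemma local_homeo_inj:
  "local_homeo X f \<Longrightarrow> f x = Some z \<Longrightarrow> f y = Some z \<Longrightarrow> x = y"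
  by (simp add: local_homeo_iff)

lemma local_homeo_dom: "local_homeo X f \<Longrightarrow> dom f \<subseteq> topspace X"
  by (simp only: local_homeo_iff)

lemma local_homeo_ran: "local_homeo X f \<Longrightarrow> ran f \<subseteq> topspace X"
  by (simp only: local_homeo_iff)

lemma local_homeo_open_preimage:
  "local_homeo X f \<Longrightarrow> openin X U \<Longrightarrow> openin X {x. \<exists>y\<in>U. f x = Some y}"
  by (simp add: local_homeo_iff)

lemma local_homeo_open_image:
  "local_homeo X f \<Longrightarrow> openin X U \<Longrightarrow> openin X {y. \<exists>x\<in>U. f x = Some y}"
  by (simp add: local_homeo_iff)

lemma local_homeo_comp:
  assumes f: "local_homeo X f" and g: "local_homeo X g"
  shows "local_homeo X (f \<circ>\<^sub>m g)"
  unfolding local_homeo_iff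
proof (intro conjI allI impI)
  show "dom (f \<circ>\<^sub>m g) \<subseteq> topspace X"
  proof -
    have "dom (f \<circ>\<^sub>m g) \<subseteq> dom g" by (auto simp: map_comp_Some_iff)
    then show ?thesis using local_homeo_dom[OF g] by (rule order_trans)
  qed
  show "ran (f \<circ>\<^sub>m g) \<subseteq> topspace X"
  proof -
    have "ran (f \<circ>\<^sub>m g) \<subseteq> ran f" by (auto simp: map_comp_Some_iff ran_def)
    then show ?thesis using local_homeo_ran[OF f] by (rule order_trans)
  qed
  show "x = y" if fg: "(f \<circ>\<^sub>m g) x = Some z" "(f \<circ>\<^sub>m g) y = Some z" for x y z
  proof -
    obtain u where u: "g x = Some u" "f u = Some z" using fg(1) by (auto simp: map_comp_Some_iff)
    obtain v where v: "g y = Some v" "f v = Some z" using fg(2) by (auto simp: map_comp_Some_iff)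
    have "u = v" by (rule local_homeo_inj[OF f u(2) v(2)])
    then show ?thesis using local_homeo_inj[OF g u(1)] v(1) by simp
  qed
next
  fix U assume "openin X U"
  then have "openin X {x. \<exists>y\<in>{x. \<exists>y\<in>U. f x = Some y}. g x = Some y}"
    by (intro local_homeo_open_preimage[OF f] local_homeo_open_preimage[OF g])
  moreover have "{x. \<exists>y\<in>{x. \<exists>y\<in>U. f x = Some y}. g x = Some y} =
      {x. \<exists>y\<in>U. (f \<circ>\<^sub>m g) x = Some y}"
    by (auto simp: map_comp_Some_iff)
  ultimately show "openin X {x. \<exists>y\<in>U. (f \<circ>\<^sub>m g) x = Some y}" by simp
next
  fix U assume "openin X U"
  then have "openin X {y. \<exists>x\<in>{y. \<exists>x\<in>U. g x = Some y}. f x = Some y}"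
    by (intro local_homeo_open_image[OF f] local_homeo_open_image[OF g])
  moreover have "{y. \<exists>x\<in>{y. \<exists>x\<in>U. g x = Some y}. f x = Some y} =
      {y. \<exists>x\<in>U. (f \<circ>\<^sub>m g) x = Some y}"
    by (auto simp: map_comp_Some_iff)
  ultimately show "openin X {y. \<exists>x\<in>U. (f \<circ>\<^sub>m g) x = Some y}" by simp
qed

lemma local_homeo_id: "local_homeo X (Some |` topspace X)"
proof -
  have "{x. \<exists>y\<in>U. (Some |` topspace X) x = Some y} = U"
    and "{y. \<exists>x\<in>U. (Some |` topspace X) x = Some y} = U" if "openin X U" for U
    using openin_subset[OF that] by (auto simp: restrict_map_def)
  then show ?thesis
    unfolding local_homeo_iff by (auto simp: ran_def restrict_map_def split: if_splits)
qed

text \<open>Meant for injective \<open>f\<close>, where the choice is forced and the result is the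
  inverse, with domain \<open>ran f\<close>.\<close>

definition map_inv :: "('a \<rightharpoonup> 'b) \<Rightarrow> ('b \<rightharpoonup> 'a)" where
  "map_inv f = (\<lambda>y. if \<exists>x. f x = Some y then Some (SOME x. f x = Some y) else None)"

lemma map_inv_Some_iff:
  assumes "\<And>x y z. f x = Some z \<Longrightarrow> f y = Some z \<Longrightarrow> x = y"
  shows "map_inv f y = Some x \<longleftrightarrow> f x = Some y"
  unfolding map_inv_def using assms by (auto intro: someI)

text \<open>Inversion swaps domain with range and preimages of open sets with images, and the
  characterisation \<open>local_homeo_iff\<close> is symmetric under this swap.\<close>

lemma local_homeo_map_inv:
  assumes f: "local_homeo X f"
  shows "local_homeo X (map_inv f)"
proof -
  have *: "map_inv f y = Some x \<longleftrightarrow> f x = Some y" for x y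
    by (rule map_inv_Some_iff) (rule local_homeo_inj[OF f])
  have "dom (map_inv f) = ran f" "ran (map_inv f) = dom f"
    by (auto simp: ran_def dom_def *)
  then show ?thesis
    using f unfolding local_homeo_iff * by auto
qed

section \<open>Orientation-preserving local homeomorphisms of the line\<close>

text \<open>Since the domain is open, any neighbourhood of \<open>x\<close> can be shrunk to a ball
  inside it. The relational form, free of \<open>the\<close>, carries over easily to composites and
  inverses.\<close>

lemma op_local_homeo_iff:
  "op_local_homeo h \<longleftrightarrow>
     local_homeo euclideanreal h \<and>
     (\<forall>x\<in>dom h. \<exists>U. open U \<and> x \<in> U \<and>
        (\<forall>a\<in>U. \<forall>b\<in>U. \<forall>a' b'. h a = Some a' \<longrightarrow> h b = Some b' \<longrightarrow> a < b \<longrightarrow> a' < b'))"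
  (is "_ \<longleftrightarrow> ?L \<and> ?M")
proof
  assume A: "op_local_homeo h"
  show "?L \<and> ?M"
  proof (intro conjI ballI)
    show ?L using A by (simp add: op_local_homeo_def)
    fix x assume "x \<in> dom h"
    then obtain e where e: "e > 0" "strict_mono_on (ball x e) (\<lambda>y. the (h y))"
      using A unfolding op_local_homeo_def by blast
    have "a' < b'"
      if "a \<in> ball x e" "b \<in> ball x e" "h a = Some a'" "h b = Some b'" "a < b" for a b a' b'
      using strict_mono_onD[OF e(2) that(1,2,5)] that by simp
    then show "\<exists>U. open U \<and> x \<in> U \<and>
        (\<forall>a\<in>U. \<forall>b\<in>U. \<forall>a' b'. h a = Some a' \<longrightarrow> h b = Some b' \<longrightarrow> a < b \<longrightarrow> a' < b')"
      using e(1) open_ball centre_in_ball by meson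
  qed
next
  assume A: "?L \<and> ?M"
  show "op_local_homeo h"
    unfolding op_local_homeo_def
  proof (intro conjI ballI)
    show "local_homeo euclideanreal h" using A by simp
    fix x assume x: "x \<in> dom h"
    then obtain U where U: "open U" "x \<in> U"
      "\<forall>a\<in>U. \<forall>b\<in>U. \<forall>a' b'. h a = Some a' \<longrightarrow> h b = Some b' \<longrightarrow> a < b \<longrightarrow> a' < b'"
      using A by blast
    have "open (U \<inter> dom h)" using U A by (auto simp: local_homeo_def)
    then obtain e where e: "e > 0" "ball x e \<subseteq> U \<inter> dom h"
      using x U(2) open_contains_ball by (metis IntI)
    have "strict_mono_on (ball x e) (\<lambda>y. the (h y))"
    proof (rule strict_mono_onI)
      fix a b assume ab: "a \<in> ball x e" "b \<in> ball x e" "a < b"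
      then have "a \<in> U" "b \<in> U" "a \<in> dom h" "b \<in> dom h" using e(2) by blast+
      then show "the (h a) < the (h b)" using U(3) ab(3) by auto
    qed
    then show "\<exists>e>0. ball x e \<subseteq> dom h \<and> strict_mono_on (ball x e) (\<lambda>y. the (h y))"
      using e by blast
  qed
qed

lemma op_local_homeo_comp:
  assumes h: "op_local_homeo h" and k: "op_local_homeo k"
  shows "op_local_homeo (h \<circ>\<^sub>m k)"
  unfolding op_local_homeo_iff
proof (intro conjI ballI)
  show "local_homeo euclideanreal (h \<circ>\<^sub>m k)"
    using h k by (simp add: op_local_homeo_def local_homeo_comp)
  fix x assume "x \<in> dom (h \<circ>\<^sub>m k)"
  then obtain y z where y: "k x = Some y" and z: "h y = Some z"
    by (auto simp: map_comp_Some_iff)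
  obtain U where U: "open U" "x \<in> U"
    "\<And>a b a' b'. a \<in> U \<Longrightarrow> b \<in> U \<Longrightarrow> k a = Some a' \<Longrightarrow> k b = Some b' \<Longrightarrow> a < b \<Longrightarrow> a' < b'"
    using k y unfolding op_local_homeo_iff by (meson domI)
  obtain V where V: "open V" "y \<in> V"
    "\<And>a b a' b'. a \<in> V \<Longrightarrow> b \<in> V \<Longrightarrow> h a = Some a' \<Longrightarrow> h b = Some b' \<Longrightarrow> a < b \<Longrightarrow> a' < b'"
    using h z unfolding op_local_homeo_iff by (meson domI)
  \<comment> \<open>The points of \<open>U\<close> that \<open>k\<close> sends into
    \<open>V\<close>: there the monotonicity of \<open>k\<close> and that of \<open>h\<close> apply
    in turn.\<close>
  let ?U = "U \<inter> {x. \<exists>y\<in>V. k x = Some y}"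
  have "open ?U"
    using U(1) V(1) k local_homeo_open_preimage[of euclideanreal k V]
    by (auto simp: op_local_homeo_def)
  moreover have "x \<in> ?U" using U V y by simp
  moreover have "a' < b'"
    if "a \<in> ?U" "b \<in> ?U" "(h \<circ>\<^sub>m k) a = Some a'" "(h \<circ>\<^sub>m k) b = Some b'" "a < b" for a b a' b'
    using that U(3) V(3) by (auto simp: map_comp_Some_iff)
  ultimately show "\<exists>U. open U \<and> x \<in> U \<and> (\<forall>a\<in>U. \<forall>b\<in>U. \<forall>a' b'.
      (h \<circ>\<^sub>m k) a = Some a' \<longrightarrow> (h \<circ>\<^sub>m k) b = Some b' \<longrightarrow> a < b \<longrightarrow> a' < b')"
    by meson
qed

lemma op_local_homeo_map_inv:
  assumes h: "op_local_homeo h"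
  shows "op_local_homeo (map_inv h)"
  unfolding op_local_homeo_iff
proof (intro conjI ballI)
  have L: "local_homeo euclideanreal h" using h by (simp add: op_local_homeo_def)
  then show "local_homeo euclideanreal (map_inv h)" by (rule local_homeo_map_inv)
  have *: "map_inv h y = Some x \<longleftrightarrow> h x = Some y" for x y
    by (rule map_inv_Some_iff) (rule local_homeo_inj[OF L])
  fix y assume "y \<in> dom (map_inv h)"
  then obtain x where x: "h x = Some y" using * by auto
  obtain U where U: "open U" "x \<in> U"
    "\<And>a b a' b'. a \<in> U \<Longrightarrow> b \<in> U \<Longrightarrow> h a = Some a' \<Longrightarrow> h b = Some b' \<Longrightarrow> a < b \<Longrightarrow> a' < b'"
    using h x unfolding op_local_homeo_iff by (meson domI)
  \<comment> \<open>The image of \<open>U\<close> is a neighbourhood of \<open>y\<close>, and by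
    injectivity its points have their preimages in \<open>U\<close>, where \<open>h\<close> reflects
    the order.\<close>
  let ?V = "{y. \<exists>x\<in>U. h x = Some y}"
  have "open ?V" using U(1) local_homeo_open_image[OF L] by simp
  moreover have "y \<in> ?V" using x U by blast
  moreover have "a' < b'"
    if ab: "a \<in> ?V" "b \<in> ?V" "map_inv h a = Some a'" "map_inv h b = Some b'" "a < b"
    for a b a' b'
  proof -
    have h': "h a' = Some a" "h b' = Some b" using ab * by auto
    then have "a' \<in> U" "b' \<in> U" using ab(1,2) local_homeo_inj[OF L] by blast+
    then have "b' < a' \<Longrightarrow> b < a" using U(3) h' by blast
    moreover have "a' \<noteq> b'" using h' ab(5) by auto
    ultimately show ?thesis using ab(5) by force
  qed
  ultimately show "\<exists>U. open U \<and> y \<in> U \<and> (\<forall>a\<in>U. \<forall>b\<in>U. \<forall>a' b'.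
      map_inv h a = Some a' \<longrightarrow> map_inv h b = Some b' \<longrightarrow> a < b \<longrightarrow> a' < b')"
    by meson
qed

lemma op_local_homeo_id: "op_local_homeo Some"
proof -
  have "local_homeo euclideanreal Some"
    using local_homeo_id[of euclideanreal] by (simp add: restrict_map_def)
  then show ?thesis unfolding op_local_homeo_iff by auto
qed

text \<open>Local monotonicity spreads over an interval by bisection: the property passes from two
  adjacent intervals to their union and holds for short intervals around each point. The interval
  has to lie in the domain, because \<open>h\<close> may exchange the order of different
  components.\<close>

lemma op_local_homeo_less:
  assumes h: "op_local_homeo h" and "a < b" and dom: "{a..b} \<subseteq> dom h"
  shows "the (h a) < the (h b)"
proof -
  \<comment> \<open>The guard \<open>u < v\<close> makes the property vacuous for degenerate
    intervals, which the bisection principle also covers.\<close>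
  let ?P = "\<lambda>u v. a \<le> u \<and> u < v \<and> v \<le> b \<longrightarrow> the (h u) < the (h v)"
  have "a \<le> b" using assms by simp
  then have "?P a b"
  proof (rule Bolzano[where P = ?P])
    fix u v w assume "?P u v" "?P v w" "u \<le> v" "v \<le> w"
    then show "?P u w" by (smt (verit))
  next
    fix x assume "a \<le> x" "x \<le> b"
    then have "x \<in> dom h" using dom by auto
    then obtain e where e: "e > 0" "strict_mono_on (ball x e) (\<lambda>y. the (h y))"
      using h unfolding op_local_homeo_def by blast
    have "?P u v" if "u \<le> x" "x \<le> v" "v - u < e" for u v
      using that strict_mono_onD[OF e(2), of u v] by (auto simp: dist_real_def)
    then have "\<forall>u v. u \<le> x \<and> x \<le> v \<and> v - u < e \<longrightarrow> ?P u v" by simp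
    with e(1) show "\<exists>d>0. \<forall>u v. u \<le> x \<and> x \<le> v \<and> v - u < d \<longrightarrow> ?P u v"
      by (intro exI[of _ e] conjI)
  qed
  then show ?thesis using assms by simp
qed

section \<open>Fibred homeomorphisms and the group of germs\<close>

lemma fibred_map_Some_iff:
  "fibred_map h w = Some z \<longleftrightarrow> snd z = snd w \<and> h (snd w) (fst w) = Some (fst z)"
  by (cases w; cases z) (auto simp: fibred_map_def)

lemma fibred_map_comp: "fibred_map h \<circ>\<^sub>m fibred_map k = fibred_map (\<lambda>s. h s \<circ>\<^sub>m k s)"
proof
  fix w
  show "(fibred_map h \<circ>\<^sub>m fibred_map k) w = fibred_map (\<lambda>s. h s \<circ>\<^sub>m k s) w"
    by (cases w) (auto simp: fibred_map_def map_comp_def split: option.splits)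
qed

lemma fibred_homeosI:
  assumes "local_homeo (prod_topology euclideanreal S) (fibred_map h)"
    and "fibred_map h (0, p) = Some (0, p)"
    and "\<And>s. s \<in> topspace S \<Longrightarrow> op_local_homeo (h s)"
  shows "fibred_map h \<in> fibred_homeos S p"
  using assms unfolding fibred_homeos_def by blast

lemma fibred_homeosE:
  assumes "f \<in> fibred_homeos S p"
  obtains h where "f = fibred_map h" "local_homeo (prod_topology euclideanreal S) (fibred_map h)"
    "fibred_map h (0, p) = Some (0, p)" "\<And>s. s \<in> topspace S \<Longrightarrow> op_local_homeo (h s)"
  using assms unfolding fibred_homeos_def by blast

lemma fibred_homeos_local_homeo:
  "f \<in> fibred_homeos S p \<Longrightarrow> local_homeo (prod_topology euclideanreal S) f"
  by (simp add: fibred_homeos_def)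

lemma fibred_homeos_base: "f \<in> fibred_homeos S p \<Longrightarrow> f (0, p) = Some (0, p)"
  by (simp add: fibred_homeos_def)

lemma fibred_homeos_open_dom:
  "f \<in> fibred_homeos S p \<Longrightarrow> openin (prod_topology euclideanreal S) (dom f)"
  by (simp add: fibred_homeos_def local_homeo_def)

lemma fibred_homeos_snd: "f \<in> fibred_homeos S p \<Longrightarrow> f w = Some z \<Longrightarrow> snd z = snd w"
  by (auto simp: fibred_map_Some_iff elim: fibred_homeosE)

lemma fibred_homeos_comp:
  assumes "f \<in> fibred_homeos S p" "g \<in> fibred_homeos S p"
  shows "f \<circ>\<^sub>m g \<in> fibred_homeos S p"
proof -
  obtain h where h: "f = fibred_map h" "local_homeo (prod_topology euclideanreal S) (fibred_map h)"
    "fibred_map h (0, p) = Some (0, p)" "\<And>s. s \<in> topspace S \<Longrightarrow> op_local_homeo (h s)"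
    using fibred_homeosE[OF assms(1)] by metis
  obtain k where k: "g = fibred_map k" "local_homeo (prod_topology euclideanreal S) (fibred_map k)"
    "fibred_map k (0, p) = Some (0, p)" "\<And>s. s \<in> topspace S \<Longrightarrow> op_local_homeo (k s)"
    using fibred_homeosE[OF assms(2)] by metis
  have "fibred_map (\<lambda>s. h s \<circ>\<^sub>m k s) \<in> fibred_homeos S p"
  proof (rule fibred_homeosI)
    show "local_homeo (prod_topology euclideanreal S) (fibred_map (\<lambda>s. h s \<circ>\<^sub>m k s))"
      using local_homeo_comp[OF h(2) k(2)] by (simp add: fibred_map_comp)
    show "fibred_map (\<lambda>s. h s \<circ>\<^sub>m k s) (0, p) = Some (0, p)"
      unfolding fibred_map_comp[symmetric] using h(3) k(3) by simp
  qed (simp add: op_local_homeo_comp h k)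
  then show ?thesis by (simp add: h(1) k(1) fibred_map_comp)
qed

lemma fibred_homeos_id:
  assumes "p \<in> topspace S"
  shows "Some |` topspace (prod_topology euclideanreal S) \<in> fibred_homeos S p"
proof -
  \<comment> \<open>The restricted identity is undefined over points outside
    \<open>topspace S\<close>, so the fibre map there is empty.\<close>
  let ?h = "\<lambda>s. if s \<in> topspace S then Some else Map.empty"
  have *: "Some |` topspace (prod_topology euclideanreal S) = fibred_map ?h"
    by (rule ext) (auto simp: fibred_map_def restrict_map_def split: if_splits)
  show ?thesis
    unfolding *
  proof (rule fibred_homeosI)
    show "local_homeo (prod_topology euclideanreal S) (fibred_map ?h)"
      unfolding *[symmetric] by (rule local_homeo_id)
    show "fibred_map ?h (0, p) = Some (0, p)" using assms by (simp add: fibred_map_def)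
  qed (simp add: op_local_homeo_id)
qed

text \<open>The inverse is again fibred, with the inverses of the \<open>h s\<close> as its fibre
  maps.\<close>

lemma fibred_homeos_map_inv:
  assumes "f \<in> fibred_homeos S p"
  shows "map_inv f \<in> fibred_homeos S p"
proof -
  obtain h where h: "f = fibred_map h" "local_homeo (prod_topology euclideanreal S) (fibred_map h)"
    "fibred_map h (0, p) = Some (0, p)" "\<And>s. s \<in> topspace S \<Longrightarrow> op_local_homeo (h s)"
    using fibred_homeosE[OF assms] by metis
  have f: "map_inv f z = Some w \<longleftrightarrow> f w = Some z" for w z
    unfolding h(1) by (rule map_inv_Some_iff) (rule local_homeo_inj[OF h(2)])
  \<comment> \<open>Injectivity of \<open>h s\<close> is read off the total map, which covers every
    \<open>s\<close>, also those outside \<open>topspace S\<close>.\<close>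
  have hs: "map_inv (h s) y = Some x \<longleftrightarrow> h s x = Some y" for s x y
  proof (rule map_inv_Some_iff)
    fix u v z assume "h s u = Some z" "h s v = Some z"
    then have "fibred_map h (u, s) = Some (z, s)" "fibred_map h (v, s) = Some (z, s)"
      by (simp_all add: fibred_map_Some_iff)
    then show "u = v" using local_homeo_inj[OF h(2)] by blast
  qed
  have *: "map_inv f = fibred_map (\<lambda>s. map_inv (h s))"
  proof (rule ext, rule option.expand)
    have "map_inv f z = Some w \<longleftrightarrow> fibred_map (\<lambda>s. map_inv (h s)) z = Some w" for z w
      unfolding f fibred_map_Some_iff hs unfolding h(1) fibred_map_Some_iff by auto
    then show "(map_inv f z = None) = (fibred_map (\<lambda>s. map_inv (h s)) z = None)"
      and "the (map_inv f z) = the (fibred_map (\<lambda>s. map_inv (h s)) z)" for z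
      by (metis not_Some_eq)+
  qed
  show ?thesis
    unfolding *
  proof (rule fibred_homeosI)
    show "local_homeo (prod_topology euclideanreal S) (fibred_map (\<lambda>s. map_inv (h s)))"
      unfolding *[symmetric] h(1) by (rule local_homeo_map_inv[OF h(2)])
    show "fibred_map (\<lambda>s. map_inv (h s)) (0, p) = Some (0, p)"
      unfolding *[symmetric] f using h(1,3) by simp
  qed (simp add: op_local_homeo_map_inv h)
qed

section \<open>Equality of germs\<close>

text \<open>Both domains are open and contain the base point, so any \<open>W\<close> on which the
  maps agree as partial functions can be cut down to lie in both.\<close>

lemma germ_rel_iff:
  "(f, g) \<in> germ_rel S p \<longleftrightarrow> f \<in> fibred_homeos S p \<and> g \<in> fibred_homeos S p \<and>
     (\<exists>W. openin (prod_topology euclideanreal S) W \<and> (0, p) \<in> W \<and> (\<forall>w\<in>W. f w = g w))"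
  (is "?L \<longleftrightarrow> ?R")
proof
  assume ?R
  then obtain W where f: "f \<in> fibred_homeos S p" "g \<in> fibred_homeos S p"
    and W: "openin (prod_topology euclideanreal S) W" "(0, p) \<in> W" "\<forall>w\<in>W. f w = g w"
    by blast
  let ?W = "W \<inter> dom f \<inter> dom g"
  have "openin (prod_topology euclideanreal S) ?W"
    using f W(1) by (simp add: openin_Int fibred_homeos_open_dom)
  moreover have "(0, p) \<in> ?W" using f W(2) by (auto dest: fibred_homeos_base)
  ultimately show ?L using f W(3) unfolding germ_rel_def by blast
qed (auto simp: germ_rel_def)

lemma germ_rel_refl: "p \<in> topspace S \<Longrightarrow> f \<in> fibred_homeos S p \<Longrightarrow> (f, f) \<in> germ_rel S p"
  unfolding germ_rel_iff
  by (intro conjI exI[of _ "topspace (prod_topology euclideanreal S)"] openin_topspace) auto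

lemma equiv_germ_rel:
  assumes "p \<in> topspace S"
  shows "equiv (fibred_homeos S p) (germ_rel S p)"
proof (rule equivI)
  show "germ_rel S p \<subseteq> fibred_homeos S p \<times> fibred_homeos S p"
    by (auto simp: germ_rel_iff)
  show "refl_on (fibred_homeos S p) (germ_rel S p)"
    using germ_rel_refl[OF assms] by (auto simp: refl_on_def germ_rel_iff)
  show "sym (germ_rel S p)"
    unfolding sym_def germ_rel_iff by metis
  show "trans (germ_rel S p)"
  proof (rule transI)
    fix f g h assume "(f, g) \<in> germ_rel S p" "(g, h) \<in> germ_rel S p"
    then obtain V W where fh: "f \<in> fibred_homeos S p" "h \<in> fibred_homeos S p"
      and V: "openin (prod_topology euclideanreal S) V" "(0, p) \<in> V" "\<forall>w\<in>V. f w = g w"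
      and W: "openin (prod_topology euclideanreal S) W" "(0, p) \<in> W" "\<forall>w\<in>W. g w = h w"
      unfolding germ_rel_iff by blast
    have "openin (prod_topology euclideanreal S) (V \<inter> W)" "(0, p) \<in> V \<inter> W"
      "\<forall>w\<in>V \<inter> W. f w = h w"
      using V W by auto
    then show "(f, h) \<in> germ_rel S p" using fh unfolding germ_rel_iff by blast
  qed
qed

text \<open>This makes multiplication of germs well defined. As \<open>g\<close> is continuous and
  fixes the base point, it sends nearby points into the neighbourhood where \<open>f\<close> and
  \<open>f'\<close> agree.\<close>

lemma germ_rel_comp:
  assumes f: "(f, f') \<in> germ_rel S p" and g: "(g, g') \<in> germ_rel S p"
  shows "(f \<circ>\<^sub>m g, f' \<circ>\<^sub>m g') \<in> germ_rel S p"
proof -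
  obtain V where V: "openin (prod_topology euclideanreal S) V" "(0, p) \<in> V" "\<forall>w\<in>V. f w = f' w"
    using f unfolding germ_rel_iff by blast
  obtain W where W: "openin (prod_topology euclideanreal S) W" "(0, p) \<in> W" "\<forall>w\<in>W. g w = g' w"
    using g unfolding germ_rel_iff by blast
  have fg: "f \<in> fibred_homeos S p" "g \<in> fibred_homeos S p"
    "f' \<in> fibred_homeos S p" "g' \<in> fibred_homeos S p"
    using f g unfolding germ_rel_iff by auto
  let ?U = "W \<inter> {w. \<exists>z\<in>V. g w = Some z}"
  have "openin (prod_topology euclideanreal S) ?U"
    using local_homeo_open_preimage[OF fibred_homeos_local_homeo[OF fg(2)] V(1)] W(1) by auto
  moreover have "(0, p) \<in> ?U" using V W fibred_homeos_base[OF fg(2)] by simp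
  moreover have "(f \<circ>\<^sub>m g) w = (f' \<circ>\<^sub>m g') w" if "w \<in> ?U" for w
  proof -
    obtain z where "g w = Some z" "z \<in> V" using \<open>w \<in> ?U\<close> by blast
    moreover have "g' w = Some z" using W(3) \<open>w \<in> ?U\<close> calculation by simp
    ultimately show ?thesis using V(3) by simp
  qed
  ultimately show ?thesis
    unfolding germ_rel_iff using fibred_homeos_comp[OF fg(1,2)] fibred_homeos_comp[OF fg(3,4)]
    by (intro conjI exI[of _ ?U]) auto
qed

section \<open>The group structure on germs\<close>

lemma map_comp_assoc: "(f \<circ>\<^sub>m g) \<circ>\<^sub>m h = f \<circ>\<^sub>m (g \<circ>\<^sub>m h)"
  by (rule ext) (simp add: map_comp_def split: option.splits)

lemma germ_group_carrier: "carrier (germ_group S p) = fibred_homeos S p // germ_rel S p"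
  by (simp add: germ_group_def)

lemma germ_group_one:
  "\<one>\<^bsub>germ_group S p\<^esub> = germ_rel S p `` {Some |` topspace (prod_topology euclideanreal S)}"
  by (simp add: germ_group_def)

text \<open>The union over all representatives in the definition of \<open>germ_group\<close>
  collapses to a single class, because composition respects \<open>germ_rel\<close>.\<close>

lemma germ_group_mult:
  assumes p: "p \<in> topspace S" and f: "f \<in> fibred_homeos S p" and g: "g \<in> fibred_homeos S p"
  shows "germ_rel S p `` {f} \<otimes>\<^bsub>germ_group S p\<^esub> germ_rel S p `` {g} = germ_rel S p `` {f \<circ>\<^sub>m g}"
proof -
  note E = equiv_germ_rel[OF p]
  have "congruent2 (germ_rel S p) (germ_rel S p) (\<lambda>f g. germ_rel S p `` {f \<circ>\<^sub>m g})"
    by (rule congruent2I') (rule equiv_class_eq[OF E germ_rel_comp])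
  then show ?thesis
    using UN_equiv_class2[OF E E _ f g] by (simp add: germ_group_def)
qed

lemma group_germ_group:
  assumes p: "p \<in> topspace S"
  shows "group (germ_group S p)"
proof -
  note E = equiv_germ_rel[OF p]
  let ?G = "germ_group S p" and ?H = "fibred_homeos S p" and ?R = "germ_rel S p"
  let ?id = "Some |` topspace (prod_topology euclideanreal S)"
  have id: "?id \<in> ?H" by (rule fibred_homeos_id[OF p])
  have cl: "?R `` {f} \<in> carrier ?G" if "f \<in> ?H" for f
    using that by (simp add: germ_group_carrier quotientI)
  have ob: "\<exists>f\<in>?H. a = ?R `` {f}" if "a \<in> carrier ?G" for a
    using that unfolding germ_group_carrier by (auto elim: quotientE)
  show ?thesis
  proof (rule groupI)
    fix a b assume a: "a \<in> carrier ?G" and b: "b \<in> carrier ?G"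
    obtain f where "f \<in> ?H" "a = ?R `` {f}" using ob[OF a] by blast
    moreover obtain g where "g \<in> ?H" "b = ?R `` {g}" using ob[OF b] by blast
    ultimately show "a \<otimes>\<^bsub>?G\<^esub> b \<in> carrier ?G"
      by (simp add: germ_group_mult[OF p] cl fibred_homeos_comp)
  next
    show "\<one>\<^bsub>?G\<^esub> \<in> carrier ?G" unfolding germ_group_one by (rule cl[OF id])
  next
    fix a b c assume "a \<in> carrier ?G" "b \<in> carrier ?G" "c \<in> carrier ?G"
    then obtain f g h where "f \<in> ?H" "a = ?R `` {f}" "g \<in> ?H" "b = ?R `` {g}"
      "h \<in> ?H" "c = ?R `` {h}"
      using ob by metis
    then show "a \<otimes>\<^bsub>?G\<^esub> b \<otimes>\<^bsub>?G\<^esub> c = a \<otimes>\<^bsub>?G\<^esub> (b \<otimes>\<^bsub>?G\<^esub> c)"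
      by (simp add: germ_group_mult[OF p] fibred_homeos_comp map_comp_assoc)
  next
    fix a assume "a \<in> carrier ?G"
    then obtain f where f: "f \<in> ?H" "a = ?R `` {f}" using ob by blast
    \<comment> \<open>The left unit law holds already for partial maps: the values of
      \<open>f\<close> lie in the total space, where \<open>?id\<close> is the identity.\<close>
    have "?id z = Some z" if "f w = Some z" for w z
    proof -
      have "z \<in> ran f" using that by (rule ranI)
      then show ?thesis
        using local_homeo_ran[OF fibred_homeos_local_homeo[OF f(1)]] by (simp only: restrict_in subsetD)
    qed
    then have "(?id \<circ>\<^sub>m f) w = f w" for w
      by (cases "f w") (simp_all only: map_comp_simps)
    then have "?id \<circ>\<^sub>m f = f" by blast
    then show "\<one>\<^bsub>?G\<^esub> \<otimes>\<^bsub>?G\<^esub> a = a"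
      unfolding germ_group_one f(2) by (simp only: germ_group_mult[OF p id f(1)])
    have *: "map_inv f z = Some w \<longleftrightarrow> f w = Some z" for w z
      by (rule map_inv_Some_iff) (rule local_homeo_inj[OF fibred_homeos_local_homeo[OF f(1)]])
    have i: "map_inv f \<in> ?H" by (rule fibred_homeos_map_inv[OF f(1)])
    \<comment> \<open>The inverse law is proved for germs: the composite is the identity on the open
      set \<open>dom f\<close>, a neighbourhood of the base point.\<close>
    have "dom f \<subseteq> topspace (prod_topology euclideanreal S)"
      by (rule local_homeo_dom[OF fibred_homeos_local_homeo[OF f(1)]])
    then have "(map_inv f \<circ>\<^sub>m f) w = ?id w" if "w \<in> dom f" for w
      using that * by (auto simp: map_comp_def restrict_map_def)
    moreover have "openin (prod_topology euclideanreal S) (dom f)" "(0, p) \<in> dom f"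
      using fibred_homeos_open_dom[OF f(1)] fibred_homeos_base[OF f(1)] by auto
    ultimately have "(map_inv f \<circ>\<^sub>m f, ?id) \<in> ?R"
      unfolding germ_rel_iff using fibred_homeos_comp[OF i f(1)] id by blast
    then have "?R `` {map_inv f} \<otimes>\<^bsub>?G\<^esub> a = \<one>\<^bsub>?G\<^esub>"
      unfolding f(2) germ_group_mult[OF p i f(1)] germ_group_one by (rule equiv_class_eq[OF E])
    then show "\<exists>b\<in>carrier ?G. b \<otimes>\<^bsub>?G\<^esub> a = \<one>\<^bsub>?G\<^esub>" using cl[OF i] by blast
  qed
qed

section \<open>The left-invariant order\<close>

text \<open>An ultrafilter is a minimal proper filter: in the order on filters, smaller means finer
  and \<open>bot\<close> is the improper filter. Zorn's lemma is applied to the reversed order, with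
  infima bounding chains.\<close>

lemma ex_ultrafilter_le:
  fixes F :: "'a filter"
  assumes "F \<noteq> bot"
  obtains U where "U \<le> F" "U \<noteq> bot"
    "\<And>P. eventually P U \<or> eventually (\<lambda>x. \<not> P x) U"
proof -
  let ?A = "{G. G \<le> F \<and> G \<noteq> bot}"
  have "\<exists>M\<in>?A. \<forall>G\<in>?A. M \<ge> G \<longrightarrow> G = M"
  proof (rule predicate_Zorn)
    show "partial_order_on ?A (relation_of (\<ge>) ?A)"
      by (auto simp: partial_order_on_def preorder_on_def refl_on_def trans_def antisym_def
          relation_of_def)
    fix C assume C: "C \<in> Chains (relation_of (\<ge>) ?A)"
    show "\<exists>u\<in>?A. \<forall>a\<in>C. a \<ge> u"
    proof (cases "C = {}")
      case True
      then show ?thesis using assms by blast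
    next
      case False
      have CA: "C \<subseteq> ?A" and lin: "G \<le> H \<or> H \<le> G" if "G \<in> C" "H \<in> C" for G H
        using C that unfolding Chains_def relation_of_def by auto
      \<comment> \<open>The chain is directed, so its infimum could be improper only if one of its
        members were.\<close>
      have "\<exists>x\<in>C. x \<le> inf G H" if "G \<in> C" "H \<in> C" for G H
        using lin[OF that] that by (metis inf.absorb1 inf.absorb2 order_refl)
      then have "eventually (\<lambda>_. False) (Inf C) \<longleftrightarrow> (\<exists>G\<in>C. eventually (\<lambda>_. False) G)"
        by (intro eventually_Inf_base False)
      then have "Inf C \<noteq> bot"
        using CA False by (auto simp: trivial_limit_def)
      moreover have "Inf C \<le> F"
        using CA False by (metis (no_types, lifting) Inf_lower ex_in_conv mem_Collect_eq
            order_trans subsetD)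
      ultimately show ?thesis by (auto intro: Inf_lower)
    qed
  qed
  then obtain M where M: "M \<le> F" "M \<noteq> bot"
    and max: "\<And>G. G \<le> F \<Longrightarrow> G \<noteq> bot \<Longrightarrow> G \<le> M \<Longrightarrow> G = M"
    by auto
  \<comment> \<open>Adjoining \<open>P\<close> to \<open>M\<close> gives either the improper filter,
    so that the negation of \<open>P\<close> already holds eventually, or a proper filter, which by
    minimality is \<open>M\<close> itself.\<close>
  have "eventually P M \<or> eventually (\<lambda>x. \<not> P x) M" for P
  proof (cases "inf M (principal {x. P x}) = bot")
    case True
    then show ?thesis
      by (simp add: trivial_limit_def eventually_inf_principal)
  next
    case False
    then have "inf M (principal {x. P x}) = M"
      using M(1) by (intro max) (auto intro: le_infI1)
    then have "M \<le> principal {x. P x}" by (metis inf.cobounded2)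
    then show ?thesis by (simp add: le_principal)
  qed
  then show ?thesis using that M by blast
qed

text \<open>A filter on sets rather than on points: for \<open>x\<close> in the space, a property
  holds eventually if it holds for all open neighbourhoods of \<open>x\<close> inside some fixed
  one.\<close>

definition small_nhds :: "'a topology \<Rightarrow> 'a \<Rightarrow> 'a set filter" where
  "small_nhds X x =
     (INF V\<in>{V. openin X V \<and> x \<in> V}. principal {W. openin X W \<and> x \<in> W \<and> W \<subseteq> V})"

lemma eventually_small_nhds:
  "openin X V \<Longrightarrow> x \<in> V \<Longrightarrow>
     eventually (\<lambda>W. openin X W \<and> x \<in> W \<and> W \<subseteq> V) (small_nhds X x)"
  unfolding small_nhds_def by (rule eventually_INF1[of V]) (auto simp: eventually_principal)

text \<open>The generating sets are directed through intersections of neighbourhoods, and each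
  contains the \<open>V\<close> that indexes it, so none is empty.\<close>

lemma small_nhds_nontrivial:
  assumes "x \<in> topspace X"
  shows "small_nhds X x \<noteq> bot"
proof -
  let ?N = "{V. openin X V \<and> x \<in> V}"
  have "eventually (\<lambda>_. False) (small_nhds X x) \<longleftrightarrow>
      (\<exists>V\<in>?N. eventually (\<lambda>_. False) (principal {W. openin X W \<and> x \<in> W \<and> W \<subseteq> V}))"
    unfolding small_nhds_def
  proof (rule eventually_INF_base)
    show "?N \<noteq> {}" using assms by blast
    fix U V assume "U \<in> ?N" "V \<in> ?N"
    then show "\<exists>W\<in>?N. principal {Y. openin X Y \<and> x \<in> Y \<and> Y \<subseteq> W} \<le>
        inf (principal {W. openin X W \<and> x \<in> W \<and> W \<subseteq> U})
          (principal {W. openin X W \<and> x \<in> W \<and> W \<subseteq> V})"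
      by (intro bexI[of _ "U \<inter> V"]) auto
  qed
  then show ?thesis by (auto simp: trivial_limit_def eventually_principal)
qed

text \<open>The set \<open>B\<close> is a box whose real factor is an interval. The segment between
  two points of \<open>B\<close> on one fibre therefore stays in the domain, and
  \<open>op_local_homeo_less\<close> applies to it.\<close>

lemma fibred_homeos_increasing:
  assumes f: "f \<in> fibred_homeos S p"
  obtains B where "openin (prod_topology euclideanreal S) B" "(0, p) \<in> B" "B \<subseteq> dom f"
    "\<And>z w. z \<in> B \<Longrightarrow> w \<in> B \<Longrightarrow> snd z = snd w \<Longrightarrow> fst z < fst w \<Longrightarrow>
       fst (the (f z)) < fst (the (f w))"
proof -
  obtain h where h: "f = fibred_map h" "\<And>s. s \<in> topspace S \<Longrightarrow> op_local_homeo (h s)"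
    using fibred_homeosE[OF f] by metis
  have "(0, p) \<in> dom f" using fibred_homeos_base[OF f] by blast
  then obtain T V where T: "open T" "0 \<in> T" and V: "openin S V" "p \<in> V" and TV: "T \<times> V \<subseteq> dom f"
    using iffD1[OF openin_prod_topology_alt fibred_homeos_open_dom[OF f], rule_format]
    unfolding open_openin[symmetric] by metis
  obtain e where e: "e > 0" "ball 0 e \<subseteq> T"
    using T open_contains_ball by blast
  show ?thesis
  proof (rule that[of "ball 0 e \<times> V"])
    show "openin (prod_topology euclideanreal S) (ball 0 e \<times> V)"
      using V by (simp add: openin_prod_Times_iff)
    show "(0, p) \<in> ball 0 e \<times> V" using V e by simp
    show "ball 0 e \<times> V \<subseteq> dom f" using e TV by blast
  next
    fix z w :: "real \<times> 'a"
    assume z: "z \<in> ball 0 e \<times> V" and w: "w \<in> ball 0 e \<times> V" and s: "snd z = snd w"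
      and less: "fst z < fst w"
    define s where "s = snd w"
    have sV: "s \<in> V" using w by (auto simp: s_def)
    then have op: "op_local_homeo (h s)" using h(2) openin_subset[OF V(1)] by blast
    have val: "\<exists>y. h s x = Some y \<and> f (x, s) = Some (y, s)" if "x \<in> ball 0 e" for x
    proof -
      have "(x, s) \<in> dom f" using that sV e TV by blast
      then show ?thesis unfolding h(1) by (auto simp: fibred_map_def)
    qed
    have "{fst z..fst w} \<subseteq> ball 0 e"
      using z w by (auto simp: dist_real_def)
    then have "{fst z..fst w} \<subseteq> dom (h s)" using val by blast
    then have "the (h s (fst z)) < the (h s (fst w))"
      by (rule op_local_homeo_less[OF op less])
    moreover have "z = (fst z, s)" "w = (fst w, s)" using s by (simp_all add: s_def prod_eq_iff)
    moreover have "fst z \<in> ball 0 e" "fst w \<in> ball 0 e" using z w by auto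
    ultimately show "fst (the (f z)) < fst (the (f w))"
      using val by (metis fst_conv option.sel)
  qed
qed

section \<open>Comparison at the first difference\<close>

text \<open>The lexicographic comparison of maps on \<open>W\<close> along \<open>r\<close>. The
  strict inequality forces the maps to differ at \<open>x\<close>, so \<open>x\<close> is their
  first difference in \<open>W\<close>. The values under \<open>the\<close> are genuine once
  \<open>W\<close> lies in both domains.\<close>

definition first_less ::
  "(real \<times> 's) rel \<Rightarrow> (real \<times> 's) set \<Rightarrow> (real \<times> 's \<rightharpoonup> real \<times> 's) \<Rightarrow> (real \<times> 's \<rightharpoonup> real \<times> 's) \<Rightarrow> bool"
  where
  "first_less r W f g \<longleftrightarrow>
     (\<exists>x\<in>W. fst (the (f x)) < fst (the (g x)) \<and> (\<forall>y\<in>W. (y, x) \<in> r \<longrightarrow> f y = g y))"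

lemma first_less_irrefl: "\<not> first_less r W f f"
  by (simp add: first_less_def)

text \<open>The earlier of the two witnesses serves for \<open>f\<close> and \<open>h\<close>:
  before it all three maps agree on \<open>W\<close>, and at it at least one inequality is strict
  while the other is strict or an equality.\<close>

lemma first_less_trans:
  assumes r: "trans r" "total r" and fg: "first_less r W f g" and gh: "first_less r W g h"
  shows "first_less r W f h"
proof -
  obtain x where x: "x \<in> W" "fst (the (f x)) < fst (the (g x))"
    "\<And>y. y \<in> W \<Longrightarrow> (y, x) \<in> r \<Longrightarrow> f y = g y"
    using fg unfolding first_less_def by blast
  obtain z where z: "z \<in> W" "fst (the (g z)) < fst (the (h z))"
    "\<And>y. y \<in> W \<Longrightarrow> (y, z) \<in> r \<Longrightarrow> g y = h y"
    using gh unfolding first_less_def by blast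
  consider "x = z" | "(x, z) \<in> r" | "(z, x) \<in> r" using r(2) unfolding total_on_def by blast
  then show ?thesis
  proof cases
    case 1
    then show ?thesis using x z unfolding first_less_def by (metis order_less_trans)
  next
    case 2
    then show ?thesis using x z transD[OF r(1)] unfolding first_less_def by metis
  next
    case 3
    then show ?thesis using x z transD[OF r(1)] unfolding first_less_def by metis
  qed
qed

text \<open>Well-foundedness provides a first point of difference. The two values there lie on the
  same fibre, so they differ in the real coordinate.\<close>

lemma first_less_total:
  assumes r: "wf r" and fg: "f \<in> fibred_homeos S p" "g \<in> fibred_homeos S p"
    and W: "W \<subseteq> dom f" "W \<subseteq> dom g" and neq: "\<exists>w\<in>W. f w \<noteq> g w"
  shows "first_less r W f g \<or> first_less r W g f"
proof -
  let ?A = "{w \<in> W. f w \<noteq> g w}"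
  have "\<exists>x\<in>?A. \<forall>y. (y, x) \<in> r \<longrightarrow> y \<notin> ?A"
    using r[unfolded wf_eq_minimal, rule_format, of _ ?A] neq by auto
  then obtain x where "x \<in> ?A" "\<forall>y. (y, x) \<in> r \<longrightarrow> y \<notin> ?A" by (rule bexE)
  then have x: "x \<in> W" "f x \<noteq> g x" "\<And>y. (y, x) \<in> r \<Longrightarrow> y \<in> W \<Longrightarrow> f y = g y"
    by auto
  obtain u v where uv: "f x = Some u" "g x = Some v" using W x(1) by blast
  then have "snd u = snd v" using fg fibred_homeos_snd by metis
  then have "fst u \<noteq> fst v" using x(2) uv by (auto simp: prod_eq_iff)
  then show ?thesis
    unfolding first_less_def using x uv by (metis linorder_neqE option.sel)
qed

lemma first_less_cong:
  "\<forall>w\<in>W. f w = f' w \<Longrightarrow> \<forall>w\<in>W. g w = g' w \<Longrightarrow> first_less r W f g \<longleftrightarrow> first_less r W f' g'"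
  unfolding first_less_def by simp

text \<open>The same witness works after composition: agreement at earlier points survives any
  \<open>f\<close>, and the strict inequality survives because both values lie in \<open>B\<close>
  on one fibre, where \<open>f\<close> is increasing.\<close>

lemma first_less_comp:
  assumes f: "\<And>z w. z \<in> B \<Longrightarrow> w \<in> B \<Longrightarrow> snd z = snd w \<Longrightarrow> fst z < fst w \<Longrightarrow>
       fst (the (f z)) < fst (the (f w))"
    and gh: "g \<in> fibred_homeos S p" "h \<in> fibred_homeos S p"
    and W: "W \<subseteq> {w. \<exists>z\<in>B. g w = Some z}" "W \<subseteq> {w. \<exists>z\<in>B. h w = Some z}"
    and less: "first_less r W g h"
  shows "first_less r W (f \<circ>\<^sub>m g) (f \<circ>\<^sub>m h)"
proof -
  obtain x where x: "x \<in> W" "fst (the (g x)) < fst (the (h x))"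
    "\<And>y. y \<in> W \<Longrightarrow> (y, x) \<in> r \<Longrightarrow> g y = h y"
    using less unfolding first_less_def by blast
  obtain u v where uv: "u \<in> B" "g x = Some u" "v \<in> B" "h x = Some v" using W x(1) by blast
  then have "snd u = snd v" using gh fibred_homeos_snd by metis
  then have "fst (the (f u)) < fst (the (f v))" using f uv x(2) by simp
  then have "fst (the ((f \<circ>\<^sub>m g) x)) < fst (the ((f \<circ>\<^sub>m h) x))"
    using uv by simp
  moreover have "(f \<circ>\<^sub>m g) y = (f \<circ>\<^sub>m h) y" if "y \<in> W" "(y, x) \<in> r" for y
    using x(3)[OF that] by (simp add: map_comp_def)
  ultimately show ?thesis using x(1) unfolding first_less_def by blast
qed

section \<open>The left-invariant order on germs\<close>

lemma left_orderable_germ_group: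
  assumes p: "p \<in> topspace S"
  shows "left_orderable (germ_group S p)"
proof -
  note E = equiv_germ_rel[OF p]
  let ?G = "germ_group S p" and ?H = "fibred_homeos S p" and ?R = "germ_rel S p"
  let ?X = "prod_topology euclideanreal S"
  obtain r0 :: "(real \<times> 'a) rel" where r0: "Well_order r0" "Field r0 = UNIV"
    using well_ordering[where 'a = "real \<times> 'a"] by blast
  \<comment> \<open>The strict part of the well-order is transitive, total and well-founded, as the
    lexicographic comparison requires.\<close>
  define r where "r = r0 - Id"
  have wf: "wf r" using r0 by (simp add: r_def well_order_on_def)
  have lin: "linear_order_on UNIV r0" using r0 by (simp add: well_order_on_def)
  have r: "trans r" "total r"
    using strict_linear_order_on_diff_Id[OF lin]
    by (simp_all add: r_def strict_linear_order_on_def)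
  have "small_nhds ?X (0, p) \<noteq> bot" using p by (intro small_nhds_nontrivial) simp
  then obtain U where U: "U \<le> small_nhds ?X (0, p)" "U \<noteq> bot"
    and ultra: "\<And>P. eventually P U \<or> eventually (\<lambda>x. \<not> P x) U"
    using ex_ultrafilter_le by metis
  \<comment> \<open>The ultrafilter concentrates on the neighbourhoods inside any given one, so
    whatever all small \<open>W\<close> satisfy holds eventually.\<close>
  have small: "eventually (\<lambda>W. openin ?X W \<and> (0, p) \<in> W \<and> W \<subseteq> V) U"
    if "openin ?X V" "(0, p) \<in> V" for V
    using filter_leD[OF U(1) eventually_small_nhds[OF that]] .
  define less where "less f g \<longleftrightarrow> eventually (\<lambda>W. first_less r W f g) U" for f g
  \<comment> \<open>On a \<open>W\<close> where old and new representatives agree, the comparison is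
    unchanged, and all small \<open>W\<close> are of this kind.\<close>
  have less_cong: "less f' g'" if fg: "less f g" "(f, f') \<in> ?R" "(g, g') \<in> ?R" for f g f' g'
  proof -
    obtain V where V: "openin ?X V" "(0, p) \<in> V" "\<forall>w\<in>V. f w = f' w"
      using fg(2) unfolding germ_rel_iff by blast
    obtain V' where V': "openin ?X V'" "(0, p) \<in> V'" "\<forall>w\<in>V'. g w = g' w"
      using fg(3) unfolding germ_rel_iff by blast
    show ?thesis
      using fg(1) small[OF V(1,2)] small[OF V'(1,2)] unfolding less_def
    proof eventually_elim
      case (elim W)
      then have "\<forall>w\<in>W. f w = f' w" "\<forall>w\<in>W. g w = g' w" using V(3) V'(3) by blast+
      then show ?case using first_less_cong elim(1) by blast
    qed
  qed
  \<comment> \<open>The definition asks for some pair of representatives; by \<open>L_iff\<close>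
    every pair gives the same answer.\<close>
  define L where "L = {(?R `` {f}, ?R `` {g}) | f g. f \<in> ?H \<and> g \<in> ?H \<and> less f g}"
  have L_iff: "(?R `` {f}, ?R `` {g}) \<in> L \<longleftrightarrow> less f g" if "f \<in> ?H" "g \<in> ?H" for f g
  proof
    assume "(?R `` {f}, ?R `` {g}) \<in> L"
    then obtain f' g' where "f' \<in> ?H" "g' \<in> ?H" "less f' g'"
      "?R `` {f} = ?R `` {f'}" "?R `` {g} = ?R `` {g'}"
      unfolding L_def by blast
    moreover then have "(f', f) \<in> ?R" "(g', g) \<in> ?R"
      using that eq_equiv_class_iff[OF E] by metis+
    ultimately show "less f g" using less_cong by blast
  qed (use that in \<open>auto simp: L_def\<close>)
  have ob: "\<exists>f\<in>?H. a = ?R `` {f}" if "a \<in> carrier ?G" for a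
    using that unfolding germ_group_carrier by (auto elim: quotientE)
  have LH: "\<exists>f\<in>?H. \<exists>g\<in>?H. a = ?R `` {f} \<and> b = ?R `` {g}" if "(a, b) \<in> L" for a b
    using that unfolding L_def by blast
  have "trans L"
  proof (rule transI)
    fix a b c assume ab: "(a, b) \<in> L" and bc: "(b, c) \<in> L"
    obtain f g where fg: "f \<in> ?H" "g \<in> ?H" "a = ?R `` {f}" "b = ?R `` {g}"
      using LH[OF ab] by blast
    obtain h where h: "h \<in> ?H" "c = ?R `` {h}" using LH[OF bc] by blast
    have "less f g" "less g h" using ab bc fg h L_iff by simp_all
    then have "less f h" unfolding less_def
      by eventually_elim (rule first_less_trans[OF r])
    then show "(a, c) \<in> L" using fg h L_iff by simp
  qed
  moreover have "irrefl L"
  proof (rule irreflI)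
    fix a show "(a, a) \<notin> L"
    proof
      assume aL: "(a, a) \<in> L"
      then obtain f where "f \<in> ?H" "a = ?R `` {f}" using LH by blast
      then have "less f f" using aL L_iff by simp
      \<comment> \<open>The comparison of \<open>f\<close> with itself fails on every
        \<open>W\<close>, so it could hold eventually only along the improper filter.\<close>
      then show False using U(2) by (simp add: less_def first_less_irrefl trivial_limit_def)
    qed
  qed
  moreover have "total_on (carrier ?G) L"
  proof (rule total_onI)
    fix a b assume "a \<in> carrier ?G" "b \<in> carrier ?G" and ab: "a \<noteq> b"
    then obtain f g where fg: "f \<in> ?H" "g \<in> ?H" "a = ?R `` {f}" "b = ?R `` {g}"
      using ob by metis
    then have nR: "(f, g) \<notin> ?R" using ab equiv_class_eq[OF E] by blast
    have "openin ?X (dom f \<inter> dom g)" "(0, p) \<in> dom f \<inter> dom g"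
      using fg(1,2) by (auto intro: fibred_homeos_open_dom dest: fibred_homeos_base)
    \<comment> \<open>Distinct germs differ somewhere on every neighbourhood, so each small
      \<open>W\<close> gives one of the two comparisons; which one may depend on
      \<open>W\<close>.\<close>
    from small[OF this] have "eventually (\<lambda>W. first_less r W f g \<or> first_less r W g f) U"
    proof eventually_elim
      case (elim W)
      then have "\<exists>w\<in>W. f w \<noteq> g w" using nR fg(1,2) unfolding germ_rel_iff by blast
      then show ?case using elim first_less_total[OF wf fg(1,2)] by simp
    qed
    \<comment> \<open>The ultrafilter decides which of the two comparisons prevails.\<close>
    moreover have "less f g \<or> eventually (\<lambda>W. \<not> first_less r W f g) U"
      unfolding less_def by (rule ultra)
    moreover have "less g f" if "eventually (\<lambda>W. first_less r W f g \<or> first_less r W g f) U"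
      "eventually (\<lambda>W. \<not> first_less r W f g) U"
      using that unfolding less_def by eventually_elim blast
    ultimately have "less f g \<or> less g f" by blast
    then show "(a, b) \<in> L \<or> (b, a) \<in> L" using fg L_iff by simp
  qed
  moreover have "(a \<otimes>\<^bsub>?G\<^esub> b, a \<otimes>\<^bsub>?G\<^esub> c) \<in> L"
    if abc: "a \<in> carrier ?G" "b \<in> carrier ?G" "c \<in> carrier ?G" "(b, c) \<in> L" for a b c
  proof -
    obtain f g h where fgh: "f \<in> ?H" "a = ?R `` {f}" "g \<in> ?H" "b = ?R `` {g}"
      "h \<in> ?H" "c = ?R `` {h}"
      using ob abc by metis
    obtain B where B: "openin ?X B" "(0, p) \<in> B"
      and inc: "\<And>z w. z \<in> B \<Longrightarrow> w \<in> B \<Longrightarrow> snd z = snd w \<Longrightarrow> fst z < fst w \<Longrightarrow>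
       fst (the (f z)) < fst (the (f w))"
      using fibred_homeos_increasing[OF fgh(1)] by metis
    \<comment> \<open>The points that \<open>k\<close> sends into \<open>B\<close>. For small
      \<open>W\<close>, both \<open>g\<close> and \<open>h\<close> map \<open>W\<close> into the box
      where \<open>f\<close> is increasing on fibres.\<close>
    let ?V = "\<lambda>k. {w. \<exists>z\<in>B. k w = Some z}"
    have V: "openin ?X (?V k)" "(0, p) \<in> ?V k" if "k \<in> ?H" for k
      using local_homeo_open_preimage[OF fibred_homeos_local_homeo[OF that] B(1)] B(2)
        fibred_homeos_base[OF that] by simp_all
    have "less g h" using fgh abc(4) L_iff by simp
    then have "less (f \<circ>\<^sub>m g) (f \<circ>\<^sub>m h)"
      using small[OF V[OF fgh(3)]] small[OF V[OF fgh(5)]] unfolding less_def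
    proof eventually_elim
      case (elim W)
      show ?case
      proof (rule first_less_comp)
        show "fst (the (f z)) < fst (the (f w))"
          if "z \<in> B" "w \<in> B" "snd z = snd w" "fst z < fst w" for z w
          using that by (rule inc)
        show "W \<subseteq> ?V g" "W \<subseteq> ?V h" "first_less r W g h" using elim by simp_all
      qed (fact fgh)+
    qed
    then show ?thesis
      using fgh by (simp add: germ_group_mult[OF p] L_iff fibred_homeos_comp)
  qed
  ultimately show ?thesis
    unfolding left_orderable_def strict_linear_order_on_def by blast
qed

theorem proposition2p6:
  fixes S :: "'s topology" and p :: 's
  assumes "metrizable_space S" and "p \<in> topspace S"
  shows "group (germ_group S p) \<and> left_orderable (germ_group S p)"
  using group_germ_group[OF assms(2)] left_orderable_germ_group[OF assms(2)] by blast

end
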